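(* Let $\{a_n\}_{n\geq 0}$ be the Narayana sequence, defined by $a_0=0$, $a_1=a_2=1$ and $a_n=a_{n-1}+a_{n-3}$ for $n\geq 3$. For every integer $n\geq 1$, \[\nu_3(a_n) = \begin{cases} 0, &\text{ if }n\equiv 1,2,3,4,6\pmod 8;\\ 1, &\text{ if }n\equiv 5,7,13,15\pmod {24};\\ 2, &\text{ if }n\equiv 8\pmod {24};\\ \nu_3(n+1)+1, &\text{ if }n\equiv 23\pmod {24};\\ \nu_3(n+3)+1, &\text{ if }n\equiv 21\pmod {24};\\ \nu_3(n)+2, &\text{ if }n\equiv 0\pmod {24};\\ \nu_3(n+8)+2, &\text{ if }n\equiv 16\pmod {24}. \end{cases}\]
   Context: For a prime $p$ and a nonzero integer $r$, $\nu_p(r)$ denotes the $p$-adic valuation of $r$, i.e. the exponent of the highest power of $p$ dividing $r$. *)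

theory Defs
  imports "HOL-Number_Theory.Number_Theory"
begin

fun narayana :: "nat \<Rightarrow> nat" where
  "narayana 0 = 0"
| "narayana (Suc 0) = 1"
| "narayana (Suc (Suc 0)) = 1"
| "narayana (Suc (Suc (Suc n))) = narayana (Suc (Suc n)) + narayana n"

end

theory Submission
  imports Defs
begin

text \<open>
  A root \<open>x\<close> of \<open>x\<^sup>3 = x\<^sup>2 + 1\<close> satisfies \<open>x\<^sup>8 = 1 + 3 A\<close> with \<open>A = 1 + x + 2 x\<^sup>2\<close>. Let \<open>t\<^sub>n = a\<^sub>n\<^sub>-\<^sub>8\<close>
  be the Narayana sequence continued to negative indices. Expanding \<open>(1 + 3 A)\<^sup>m\<close> gives
  \<open>t\<^sub>r\<^sub>+\<^sub>8\<^sub>m = (\<Sum>k\<le>m. (m choose k) 3\<^sup>k d\<^sub>k)\<close>, where \<open>d\<^sub>k\<close> is the value at \<open>r\<close> of \<open>A\<^sup>k\<close> applied to \<open>t\<close>.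
  The first nonzero \<open>d\<^sub>j\<close> is prime to \<open>3\<close> for every \<open>r < 8\<close>, and its term \<open>(m choose j) 3\<^sup>j d\<^sub>j\<close> alone
  determines the valuation. Here \<open>j = 2\<close> for \<open>r = 0\<close>, since \<open>a\<^sub>-\<^sub>8 = a\<^sub>0 = 0\<close> (and then \<open>d\<^sub>3\<close> is divisible
  by \<open>3\<close>, which compensates for \<open>3 choose 2 = 3\<close>); \<open>j = 1\<close> for \<open>r = 5, 7\<close>, since \<open>a\<^sub>-\<^sub>3 = a\<^sub>-\<^sub>1 = 0\<close>;
  and \<open>j = 0\<close> otherwise.
\<close>

subsection \<open>Valuations\<close>

lemma multiplicity_of_nat_int: "multiplicity (int p) (int n) = multiplicity p n"
  by (simp add: multiplicity_def flip: of_nat_power)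

lemma multiplicity_add_eq_left:
  fixes p a b :: "'a :: factorial_semiring"
  assumes "a \<noteq> 0" "\<not> is_unit p" "p ^ Suc (multiplicity p a) dvd b"
  shows "multiplicity p (a + b) = multiplicity p a"
proof (rule multiplicity_eqI)
  have "p ^ multiplicity p a dvd b"
    using assms(3) by (rule power_le_dvd) simp
  then show "p ^ multiplicity p a dvd a + b"
    by (intro dvd_add multiplicity_dvd)
  have "\<not> p ^ Suc (multiplicity p a) dvd a"
    using assms(1,2) multiplicity_geI[of a p "Suc (multiplicity p a)"] by auto
  then show "\<not> p ^ Suc (multiplicity p a) dvd a + b"
    using assms(3) by (simp add: dvd_add_left_iff)
qed

lemma add_2_le_power:
  fixes p v :: nat
  assumes "p \<ge> 3" "v \<ge> 1"
  shows "v + 2 \<le> p ^ v"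
  using assms(2)
proof (induction v rule: dec_induct)
  case base
  then show ?case using assms(1) by simp
next
  case (step v)
  have "Suc v + 2 \<le> 3 * (v + 2)" by simp
  also have "\<dots> \<le> p * p ^ v"
    using assms(1) step.IH by (intro mult_le_mono)
  finally show ?case by simp
qed

lemma multiplicity_less_pred:
  fixes p k :: nat
  assumes "p \<ge> 3" "k \<ge> 2"
  shows "multiplicity p k < k - 1"
proof (cases "multiplicity p k = 0")
  case False
  then have "multiplicity p k + 2 \<le> p ^ multiplicity p k"
    using assms(1) by (intro add_2_le_power) auto
  also have "\<dots> \<le> k"
    using assms(2) by (intro dvd_imp_le multiplicity_dvd) auto
  finally show ?thesis by simp
qed (use assms in auto)

lemma multiplicity_choose_two:
  fixes p k :: nat
  assumes "prime p" "p \<noteq> 2" "k > 0"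
  shows "multiplicity p (Suc k choose 2) = multiplicity p k + multiplicity p (Suc k)"
proof -
  have "2 * (Suc k choose 2) = Suc k * k"
    using binomial_absorption[of 1 "Suc k"] by (simp add: numeral_2_eq_2)
  moreover have "\<not> p dvd 2"
    using assms(1,2) primes_dvd_imp_eq two_is_prime_nat by blast
  then have "multiplicity p (2 * (Suc k choose 2)) = multiplicity p (Suc k choose 2)"
    using assms(1) by (intro multiplicity_prime_elem_times_other) auto
  moreover have "multiplicity p (Suc k * k) = multiplicity p (Suc k) + multiplicity p k"
    using assms(1,3) by (intro prime_elem_multiplicity_mult_distrib) auto
  ultimately show ?thesis by simp
qed

lemma prime_power_multiplicity_choose_two_le:
  fixes p k :: nat
  assumes "prime p" "p \<noteq> 2" "k \<ge> 2"
  shows "p ^ multiplicity p (k choose 2) \<le> k"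
proof -
  obtain i where i: "k = Suc i" "i > 0"
    using assms(3) by (cases k) auto
  have "\<not> (p dvd i \<and> p dvd Suc i)"
    using assms(1) dvd_diff_nat[of p "Suc i" i] by auto
  then consider "multiplicity p (k choose 2) = multiplicity p i" |
      "multiplicity p (k choose 2) = multiplicity p (Suc i)"
    unfolding i(1) multiplicity_choose_two[OF assms(1,2) i(2)]
    by (auto dest: not_dvd_imp_multiplicity_0)
  then show ?thesis
    using i dvd_imp_le[OF multiplicity_dvd, of i p] dvd_imp_le[OF multiplicity_dvd, of "Suc i" p]
    by cases auto
qed

lemma multiplicity_choose_two_less:
  fixes p k :: nat
  assumes "prime p" "p \<ge> 3" "k \<ge> 4"
  shows "multiplicity p (k choose 2) < k - 2"
proof (cases "multiplicity p (k choose 2) \<le> 1")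
  case False
  then obtain v where v: "multiplicity p (k choose 2) = Suc v" "v \<ge> 1"
    by (cases "multiplicity p (k choose 2)") auto
  have "Suc v + 3 \<le> 3 * (v + 2)" by simp
  also have "\<dots> \<le> p * p ^ v"
    using assms(2) v(2) by (intro mult_le_mono add_2_le_power)
  also have "\<dots> \<le> k"
    using prime_power_multiplicity_choose_two_le[of p k] assms v(1) by simp
  finally show ?thesis using v(1) by simp
qed (use assms in auto)

subsection \<open>Binomial sums\<close>

lemma sum_choose_Suc:
  fixes f :: "nat \<Rightarrow> 'a :: semiring_1"
  shows "(\<Sum>k\<le>Suc m. of_nat (Suc m choose k) * f k) =
    (\<Sum>k\<le>m. of_nat (m choose k) * f k) + (\<Sum>k\<le>m. of_nat (m choose k) * f (Suc k))"
proof -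
  have "(\<Sum>k\<le>Suc m. of_nat (Suc m choose k) * f k) =
      f 0 + (\<Sum>k\<le>m. of_nat (m choose Suc k) * f (Suc k)) + (\<Sum>k\<le>m. of_nat (m choose k) * f (Suc k))"
    by (simp add: sum.atMost_Suc_shift distrib_right sum.distrib add_ac del: sum.atMost_Suc)
  also have "f 0 + (\<Sum>k\<le>m. of_nat (m choose Suc k) * f (Suc k)) =
      (\<Sum>k\<le>Suc m. of_nat (m choose k) * f k)"
    by (simp add: sum.atMost_Suc_shift del: sum.atMost_Suc)
  finally show ?thesis by (simp add: binomial_eq_0)
qed

lemma newton_forward_difference:
  fixes u :: "nat \<Rightarrow> nat \<Rightarrow> 'a :: comm_semiring_1"
  assumes "\<And>k m. u k (Suc m) = u k m + q * u (Suc k) m"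
  shows "u j m = (\<Sum>k\<le>m. of_nat (m choose k) * (q ^ k * u (j + k) 0))"
proof (induction m arbitrary: j)
  case 0
  then show ?case by simp
next
  case (Suc m)
  have "q * u (Suc j) m = (\<Sum>k\<le>m. of_nat (m choose k) * (q ^ Suc k * u (j + Suc k) 0))"
    by (simp add: Suc.IH[of "Suc j"] sum_distrib_left mult_ac)
  then show ?case
    unfolding assms sum_choose_Suc Suc.IH[of j] by simp
qed

lemma power_Suc_multiplicity_choose_dvd:
  fixes p m j k :: nat and x :: int
  assumes "prime p" "j \<le> k" "k \<le> m"
    and x: "int p ^ Suc (multiplicity p (k choose j)) dvd int p ^ (k - j) * x"
  shows "int p ^ Suc (multiplicity p (m choose j) + j) dvd int (m choose k) * (int p ^ k * x)"
proof -
  define v w where "v = multiplicity p (m choose j)" and "w = multiplicity p (k choose j)"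
  have "p ^ v dvd (m choose k) * (k choose j)"
    unfolding choose_mult[OF assms(2,3)] v_def by (intro dvd_mult2 multiplicity_dvd)
  then have "v \<le> multiplicity p ((m choose k) * (k choose j))"
    using assms by (intro multiplicity_geI) auto
  also have "\<dots> = multiplicity p (m choose k) + w"
    using assms by (simp add: prime_elem_multiplicity_mult_distrib w_def)
  finally have "p ^ v dvd p ^ multiplicity p (m choose k) * p ^ w"
    by (simp add: le_imp_power_dvd flip: power_add)
  then have "p ^ v dvd (m choose k) * p ^ w"
    by (meson dvd_trans mult_dvd_mono dvd_refl multiplicity_dvd)
  then have "int p ^ v dvd int (m choose k) * int p ^ w"
    by (metis of_nat_dvd_iff of_nat_mult of_nat_power)
  from mult_dvd_mono[OF this x]
  have "int p ^ w * int p ^ Suc v dvd int p ^ w * (int (m choose k) * (int p ^ (k - j) * x))"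
    by (simp add: w_def mult_ac)
  then have "int p ^ Suc v dvd int (m choose k) * (int p ^ (k - j) * x)"
    using assms(1) by (simp add: prime_gt_0_nat)
  then have "int p ^ j * int p ^ Suc v dvd int p ^ j * (int (m choose k) * (int p ^ (k - j) * x))"
    by (rule mult_dvd_mono[OF dvd_refl])
  moreover have "int p ^ k = int p ^ j * int p ^ (k - j)"
    using assms(2) by (simp flip: power_add)
  ultimately show ?thesis
    by (simp add: v_def power_add mult_ac)
qed

lemma multiplicity_binomial_sum:
  fixes d :: "nat \<Rightarrow> int" and p m j :: nat
  assumes "prime p" "j \<le> m"
    and zero: "\<And>i. i < j \<Longrightarrow> d i = 0"
    and lead: "\<not> int p dvd d j"
    and tail: "\<And>k. k > j \<Longrightarrow> int p ^ Suc (multiplicity p (k choose j)) dvd int p ^ (k - j) * d k"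
  shows "multiplicity (int p) (\<Sum>k\<le>m. int (m choose k) * (int p ^ k * d k)) =
    multiplicity p (m choose j) + j"
proof -
  define f where "f k = int (m choose k) * (int p ^ k * d k)" for k
  define v where "v = multiplicity p (m choose j) + j"
  have p: "prime_elem (int p)" "p \<noteq> 0"
    using assms(1) by auto
  have lead_nonzero: "f j \<noteq> 0"
    using assms(2) p(2) lead by (auto simp: f_def)
  have multiplicity_lead: "multiplicity (int p) (f j) = v"
    using lead_nonzero p not_dvd_imp_multiplicity_0[OF lead]
    by (simp add: f_def v_def prime_elem_multiplicity_mult_distrib multiplicity_of_nat_int)
  have "int p ^ Suc v dvd f k" if "k \<in> {j<..m}" for k
    using that power_Suc_multiplicity_choose_dvd[OF assms(1) _ _ tail] by (simp add: f_def v_def)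
  then have dvd_tail: "int p ^ Suc v dvd (\<Sum>k\<in>{j<..m}. f k)"
    by (intro dvd_sum)
  have "(\<Sum>k\<le>m. f k) = (\<Sum>k\<in>{j..m}. f k)"
    by (rule sum.mono_neutral_right) (auto simp: f_def zero)
  also have "\<dots> = f j + (\<Sum>k\<in>{j<..m}. f k)"
    using assms(2) by (rule sum.head)
  finally show ?thesis
    using multiplicity_add_eq_left[OF lead_nonzero, of "int p" "\<Sum>k\<in>{j<..m}. f k"] p dvd_tail multiplicity_lead
    by (simp add: f_def v_def del: zdvd1_eq nat_dvd_1_iff_1)
qed

subsection \<open>The Narayana recurrence\<close>

definition narayana_rec :: "(nat \<Rightarrow> 'a :: comm_ring_1) \<Rightarrow> bool" where
  "narayana_rec s \<longleftrightarrow> (\<forall>n. s (n + 3) = s (n + 2) + s n)"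

definition shift8_quot :: "(nat \<Rightarrow> 'a :: comm_ring_1) \<Rightarrow> nat \<Rightarrow> 'a" where
  "shift8_quot s n = s n + s (n + 1) + 2 * s (n + 2)"

lemma narayana_rec_add_3: "narayana_rec s \<Longrightarrow> s (n + 3) = s (n + 2) + s n"
  by (simp add: narayana_rec_def)

lemma narayana_rec_add_8:
  fixes s :: "nat \<Rightarrow> 'a :: comm_ring_1"
  assumes "narayana_rec s"
  shows "s (n + 8) = 4 * s n + 3 * s (n + 1) + 6 * s (n + 2)"
proof -
  have "s (Suc (Suc (Suc i))) = s (Suc (Suc i)) + s i" for i
    using narayana_rec_add_3[OF assms, of i] by (simp add: numeral_eq_Suc)
  then show ?thesis
    by (simp add: numeral_eq_Suc algebra_simps)
qed

lemma narayana_rec_add_8_shift8_quot: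
  assumes "narayana_rec s"
  shows "s (n + 8) = s n + 3 * shift8_quot s n"
  unfolding narayana_rec_add_8[OF assms] by (simp add: shift8_quot_def algebra_simps)

lemma narayana_rec_shift8_quot:
  assumes "narayana_rec s"
  shows "narayana_rec (shift8_quot s)"
proof -
  have "shift8_quot s (n + 3) = shift8_quot s (n + 2) + shift8_quot s n" for n
    using narayana_rec_add_3[OF assms, of n] narayana_rec_add_3[OF assms, of "n + 1"]
      narayana_rec_add_3[OF assms, of "n + 2"]
    by (simp add: shift8_quot_def algebra_simps)
  then show ?thesis by (simp add: narayana_rec_def)
qed

lemma narayana_rec_funpow_shift8_quot:
  assumes "narayana_rec s"
  shows "narayana_rec ((shift8_quot ^^ k) s)"
  by (induction k) (simp_all add: assms narayana_rec_shift8_quot)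

lemma narayana_rec_eq_binomial_sum:
  assumes "narayana_rec s"
  shows "s (r + 8 * m) = (\<Sum>k\<le>m. of_nat (m choose k) * (3 ^ k * (shift8_quot ^^ k) s r))"
proof -
  have "(shift8_quot ^^ k) s (r + 8 * Suc i) =
      (shift8_quot ^^ k) s (r + 8 * i) + 3 * (shift8_quot ^^ Suc k) s (r + 8 * i)" for k i
    using narayana_rec_add_8_shift8_quot[OF narayana_rec_funpow_shift8_quot[OF assms], of k "r + 8 * i"]
    by (simp add: add_ac)
  from newton_forward_difference[of "\<lambda>k i. (shift8_quot ^^ k) s (r + 8 * i)", OF this, of 0 m]
  show ?thesis by simp
qed

subsection \<open>The Narayana sequence\<close>

text \<open>\<open>a\<^sub>n\<^sub>-\<^sub>8\<close>, expressed through \<open>x\<^sup>-\<^sup>8 = 3 x\<^sup>2 - 3 x - 2\<close>.\<close>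

definition narayana_shifted :: "nat \<Rightarrow> int" where
  "narayana_shifted n = 3 * int (narayana (n + 2)) - 3 * int (narayana (n + 1)) - 2 * int (narayana n)"

lemma narayana_rec_narayana: "narayana_rec (\<lambda>n. int (narayana n))"
  by (simp add: narayana_rec_def numeral_eq_Suc)

lemmas narayana_add_3 = narayana_rec_add_3[OF narayana_rec_narayana]

lemma narayana_rec_narayana_shifted: "narayana_rec narayana_shifted"
proof -
  have "narayana_shifted (n + 3) = narayana_shifted (n + 2) + narayana_shifted n" for n
    using narayana_add_3[of n] narayana_add_3[of "n + 1"] narayana_add_3[of "n + 2"]
    by (simp add: narayana_shifted_def)
  then show ?thesis by (simp add: narayana_rec_def)
qed

lemma narayana_shifted_add_8: "narayana_shifted (n + 8) = int (narayana n)"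
proof -
  note add_8 = narayana_rec_add_8[OF narayana_rec_narayana]
  show ?thesis
    using add_8[of n] add_8[of "n + 1"] add_8[of "n + 2"] narayana_add_3[of n] narayana_add_3[of "n + 1"]
    by (simp add: narayana_shifted_def)
qed

lemma narayana_shifted_values:
  "narayana_shifted 0 = 0" "narayana_shifted 1 = -2" "narayana_shifted 2 = 1"
  "narayana_shifted 3 = 1" "narayana_shifted 4 = -1" "narayana_shifted 5 = 0"
  "narayana_shifted 6 = 1" "narayana_shifted 7 = 0"
  by (simp_all add: narayana_shifted_def numeral_eq_Suc)

lemma shift8_quot_narayana_shifted_values:
  "shift8_quot narayana_shifted 0 = 0" "shift8_quot narayana_shifted 5 = 1"
  "shift8_quot narayana_shifted 7 = 2"
  by (simp_all add: shift8_quot_def narayana_shifted_def numeral_eq_Suc)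

lemma multiplicity_narayana:
  fixes n r m j :: nat
  defines "d \<equiv> \<lambda>k. (shift8_quot ^^ k) narayana_shifted r"
  assumes "n + 8 = r + 8 * m" "j \<le> m"
    and "\<And>i. i < j \<Longrightarrow> d i = 0"
    and "\<not> 3 dvd d j"
    and "\<And>k. k > j \<Longrightarrow> 3 ^ Suc (multiplicity 3 (k choose j)) dvd 3 ^ (k - j) * d k"
  shows "multiplicity 3 (narayana n) = multiplicity 3 (m choose j) + j"
proof -
  have "int (narayana n) = (\<Sum>k\<le>m. int (m choose k) * (int 3 ^ k * d k))"
    unfolding d_def narayana_shifted_add_8[of n, symmetric] assms(2)
    using narayana_rec_eq_binomial_sum[OF narayana_rec_narayana_shifted] by simp
  then show ?thesis
    using multiplicity_binomial_sum[of 3 j m d] assms(3-) multiplicity_of_nat_int[of 3 "narayana n"]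
    by simp
qed

lemma multiplicity_narayana_eq_0:
  assumes "n mod 8 \<in> {1, 2, 3, 4, 6}"
  shows "multiplicity 3 (narayana n) = 0"
proof -
  have "\<not> 3 dvd narayana_shifted (n mod 8)"
    using assms by (auto simp: narayana_shifted_values simp flip: One_nat_def)
  then have "multiplicity 3 (narayana n) = multiplicity 3 ((n div 8 + 1) choose 0) + 0"
    by (intro multiplicity_narayana[where r = "n mod 8"]) auto
  then show ?thesis by simp
qed

lemma multiplicity_3_mult_8: "multiplicity (3::nat) (8 * k) = multiplicity 3 k"
  by (intro multiplicity_prime_elem_times_other) auto

lemma multiplicity_narayana_simple_zero:
  assumes "narayana_shifted (n mod 8) = 0" "\<not> 3 dvd shift8_quot narayana_shifted (n mod 8)"
  shows "multiplicity 3 (narayana n) = multiplicity 3 (n + 8 - n mod 8) + 1"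
proof -
  define m where "m = n div 8 + 1"
  have n: "n + 8 = n mod 8 + 8 * m"
    by (simp add: m_def)
  have "multiplicity 3 (narayana n) = multiplicity 3 (m choose 1) + 1"
  proof (rule multiplicity_narayana[OF n])
    fix k :: nat
    assume "k > 1"
    then have "Suc (multiplicity 3 (k choose 1)) \<le> k - 1"
      using multiplicity_less_pred[of 3 k] by simp
    then show "3 ^ Suc (multiplicity 3 (k choose 1)) dvd
        3 ^ (k - 1) * (shift8_quot ^^ k) narayana_shifted (n mod 8)"
      by (intro dvd_mult2 le_imp_power_dvd)
  qed (use assms in \<open>auto simp: m_def\<close>)
  also have "\<dots> = multiplicity 3 (n + 8 - n mod 8) + 1"
    unfolding n by (simp add: multiplicity_3_mult_8)
  finally show ?thesis .
qed

lemma multiplicity_narayana_mod_8_eq_7: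
  assumes "n mod 8 = 7"
  shows "multiplicity 3 (narayana n) = multiplicity 3 (n + 1) + 1"
  using multiplicity_narayana_simple_zero[of n]
  by (simp add: assms narayana_shifted_values shift8_quot_narayana_shifted_values)

lemma multiplicity_narayana_mod_8_eq_5:
  assumes "n mod 8 = 5"
  shows "multiplicity 3 (narayana n) = multiplicity 3 (n + 3) + 1"
  using multiplicity_narayana_simple_zero[of n]
  by (simp add: assms add.commute narayana_shifted_values shift8_quot_narayana_shifted_values)

lemma multiplicity_narayana_double_zero:
  assumes "q > 0"
  shows "multiplicity 3 (narayana (8 * q)) = multiplicity 3 (Suc q choose 2) + 2"
proof (rule multiplicity_narayana[where r = 0])
  have iterates: "(shift8_quot ^^ 2) narayana_shifted 0 = 1"
    "(shift8_quot ^^ 3) narayana_shifted 0 = 6"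
    by (simp_all add: narayana_shifted_def shift8_quot_def numeral_eq_Suc)
  show "(shift8_quot ^^ i) narayana_shifted 0 = 0" if "i < 2" for i
    using that
    by (auto simp: less_2_cases_iff narayana_shifted_values shift8_quot_narayana_shifted_values)
  show "\<not> 3 dvd (shift8_quot ^^ 2) narayana_shifted 0"
    by (simp add: iterates)
  show "3 ^ Suc (multiplicity 3 (k choose 2)) dvd
      3 ^ (k - 2) * (shift8_quot ^^ k) narayana_shifted 0" if "k > 2" for k
  proof (cases "k = 3")
    case True
    have "multiplicity 3 (3 choose 2 :: nat) = 1"
      by (simp add: choose_two multiplicity_self)
    then show ?thesis unfolding True by (simp add: iterates)
  next
    case False
    then have "Suc (multiplicity 3 (k choose 2)) \<le> k - 2"
      using that multiplicity_choose_two_less[of 3 k] by simp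
    then show ?thesis by (intro dvd_mult2 le_imp_power_dvd)
  qed
qed (use assms in auto)

lemma multiplicity_narayana_mod_8_eq_0:
  assumes "n mod 8 = 0" "n > 0"
  shows "multiplicity 3 (narayana n) = multiplicity 3 n + multiplicity 3 (n + 8) + 2"
proof -
  obtain q where n: "n = 8 * q" "q > 0" and n8: "n + 8 = 8 * Suc q"
    using assms by (auto simp: mod_eq_0_iff_dvd)
  then show ?thesis
    unfolding n8 unfolding n(1)
    by (simp add: multiplicity_narayana_double_zero multiplicity_choose_two multiplicity_3_mult_8
        del: mult_Suc_right)
qed

theorem theorem1:
  fixes n :: nat
  assumes "n \<ge> 1"
  shows "(n mod 8 \<in> {1, 2, 3, 4, 6} \<longrightarrow> multiplicity 3 (narayana n) = 0) \<and>
         (n mod 24 \<in> {5, 7, 13, 15} \<longrightarrow> multiplicity 3 (narayana n) = 1) \<and>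
         (n mod 24 = 8 \<longrightarrow> multiplicity 3 (narayana n) = 2) \<and>
         (n mod 24 = 23 \<longrightarrow> multiplicity 3 (narayana n) = multiplicity 3 (n + 1) + 1) \<and>
         (n mod 24 = 21 \<longrightarrow> multiplicity 3 (narayana n) = multiplicity 3 (n + 3) + 1) \<and>
         (n mod 24 = 0 \<longrightarrow> multiplicity 3 (narayana n) = multiplicity 3 n + 2) \<and>
         (n mod 24 = 16 \<longrightarrow> multiplicity 3 (narayana n) = multiplicity 3 (n + 8) + 2)"
proof -
  have mod_8: "n mod 8 = n mod 24 mod 8"
    by (simp add: mod_mod_cancel)
  have unit_mod_3: "multiplicity 3 (n + i) = 0" if "(n mod 24 + i) mod 3 \<noteq> 0" for i
    using that by (intro not_dvd_imp_multiplicity_0) presburger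
  show ?thesis
    using assms multiplicity_narayana_eq_0[of n] multiplicity_narayana_mod_8_eq_7[of n]
      multiplicity_narayana_mod_8_eq_5[of n] multiplicity_narayana_mod_8_eq_0[of n]
      unit_mod_3[of 0] unit_mod_3[of 1] unit_mod_3[of 3] unit_mod_3[of 8] mod_8
    by auto
qed

end
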